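(* Let $G$ be a partially ordered group with an analytic topological structure $\ll$, let $(X,d)$ be a complete and regular metric space valued in $G$, and let $T: X\to 2^X\setminus\{\emptyset\}$ be a global multi-valued $\varphi$-weak contraction on $(X,d)$ (for some mapping $\varphi: X\times X\to G_+$ with $\varphi(x,y)\prec d(x,y)$ whenever $d(x,y)\succ\theta$) which satisfies the C-condition. Then $T$ has a unique endpoint.
   Context: Partially ordered group: an abelian group $G$ (written additively, identity $\theta$, having non-identity elements) with a partial order $\preceq$ such that $a\prec b\Rightarrow a+c\prec b+c$ for all $a,b,c\in G$, where $a\prec b$ means $a\preceq b$ and $a\ne b$. Put $G_+=\{a\in G: a\succeq\theta\}$. Analytic topological structure of $G$: a non-empty binary relation $\ll$ on $G$ such that, for all $a,b,c\in G$: (t1) $a\ll b\Rightarrow a\prec b$; (t2) $a\preceq b$ and $b\ll c$ imply $a\ll c$; (t3) $a\ll b\Rightarrow a+c\ll b+c$; (t4) if $\theta\preceq a$ and $a\ll\varepsilon$ for all $\varepsilon\gg\theta$, then $a=\theta$; (t5) for every $\varepsilon\gg\theta$ there is $\eta\gg\theta$ with $\eta\ll\varepsilon$. Convergence in $G_+$: a sequence $\{a_n\}$ in $G_+$ converges to $a\in G_+$ ($a_n\to a$) if for every $\varepsilon\gg\theta$ there is a natural number $N$ with $\theta\preceq a_n-a\ll\varepsilon$ for all $n>N$. $G$ is regular if every decreasing sequence in $G_+$ (i.e. $a_{n+1}\preceq a_n$ for all $n$) converges to some $a\in G_+$. Metric space valued in $G$: a non-empty set $X$ with a map $d:X\times X\to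 G$ such that $d(x,y)\succeq\theta$, with $d(x,y)=\theta$ iff $x=y$; $d(x,y)=d(y,x)$; and $d(x,y)\preceq d(x,z)+d(z,y)$ for all $x,y,z\in X$. A sequence $\{x_n\}$ in $X$ converges to $x\in X$ if $d(x_n,x)\to\theta$; it is Cauchy if for every $\varepsilon\gg\theta$ there is $N$ with $d(x_n,x_m)\ll\varepsilon$ for all $n,m\ge N$; $(X,d)$ is complete if every Cauchy sequence converges, and regular if $G$ is regular. Global multi-valued $\varphi$-weak contraction: given $\varphi:X\times X\to G_+$ with $\varphi(x,y)\prec d(x,y)$ whenever $d(x,y)\succ\theta$, a map $T:X\to 2^X\setminus\{\emptyset\}$ such that for all $x\neq y$ in $X$, $d(x',y')\preceq\varphi(x,y)$ for all $x'\in Tx$ and all $y'\in Ty$. C-condition (for $T$ with its $\varphi$): for any two sequences $\{x_n\},\{y_n\}$ in $X$, if $d(x_n,y_n)-\varphi(x_n,y_n)\to\theta$ then $d(x_n,y_n)\to\theta$. An endpoint of $T$ is a point $x\in X$ with $Tx=\{x\}$. *)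

theory Defs
  imports Main
begin

text \<open>
  A partially ordered (abelian) group is a type of class \<^class>\<open>ordered_ab_group_add\<close>; the class
  axiom is translation invariance of \<open>\<le>\<close>, which in a group is the same as translation invariance
  of \<open><\<close>. The identity \<open>\<theta>\<close> is \<open>0\<close>, and the positive cone is \<open>{a. 0 \<le> a}\<close>. The class does not
  exclude the trivial group.
\<close>

locale analytic_topological_structure =
  fixes way_below :: "'g::ordered_ab_group_add \<Rightarrow> 'g \<Rightarrow> bool" (infix \<open>\<lless>\<close> 50)
  assumes nonempty: "\<exists>a b. a \<lless> b"
    and t1: "a \<lless> b \<Longrightarrow> a < b"
    and t2: "a \<le> b \<Longrightarrow> b \<lless> c \<Longrightarrow> a \<lless> c"
    and t3: "a \<lless> b \<Longrightarrow> a + c \<lless> b + c"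
    and t4: "0 \<le> a \<Longrightarrow> (\<And>\<epsilon>. 0 \<lless> \<epsilon> \<Longrightarrow> a \<lless> \<epsilon>) \<Longrightarrow> a = 0"
    and t5: "0 \<lless> \<epsilon> \<Longrightarrow> \<exists>\<eta>. 0 \<lless> \<eta> \<and> \<eta> \<lless> \<epsilon>"

text \<open>
  Convergence is a notion for sequences in the positive cone with limit in the positive cone, so
  membership in the cone is part of the definition. It is one-sided: \<open>a n\<close> approaches \<open>l\<close> from above.
\<close>

definition converges_to ::
    "('g::ordered_ab_group_add \<Rightarrow> 'g \<Rightarrow> bool) \<Rightarrow> (nat \<Rightarrow> 'g) \<Rightarrow> 'g \<Rightarrow> bool" where
  "converges_to ll a l \<longleftrightarrow>
     (\<forall>n. 0 \<le> a n) \<and> 0 \<le> l \<and>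
     (\<forall>\<epsilon>. ll 0 \<epsilon> \<longrightarrow> (\<exists>N. \<forall>n>N. 0 \<le> a n - l \<and> ll (a n - l) \<epsilon>))"

definition regular_group :: "('g::ordered_ab_group_add \<Rightarrow> 'g \<Rightarrow> bool) \<Rightarrow> bool" where
  "regular_group ll \<longleftrightarrow>
     (\<forall>a. (\<forall>n. 0 \<le> a n) \<and> (\<forall>n. a (Suc n) \<le> a n) \<longrightarrow> (\<exists>l. converges_to ll a l))"

locale group_valued_metric_space =
  fixes X :: "'x set" and d :: "'x \<Rightarrow> 'x \<Rightarrow> 'g::ordered_ab_group_add"
  assumes carrier_nonempty: "X \<noteq> {}"
    and nonneg: "x \<in> X \<Longrightarrow> y \<in> X \<Longrightarrow> 0 \<le> d x y"
    and zero_iff: "x \<in> X \<Longrightarrow> y \<in> X \<Longrightarrow> d x y = 0 \<longleftrightarrow> x = y"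
    and commute: "x \<in> X \<Longrightarrow> y \<in> X \<Longrightarrow> d x y = d y x"
    and triangle: "x \<in> X \<Longrightarrow> y \<in> X \<Longrightarrow> z \<in> X \<Longrightarrow> d x y \<le> d x z + d z y"

definition cauchy_seq ::
    "('g::ordered_ab_group_add \<Rightarrow> 'g \<Rightarrow> bool) \<Rightarrow> ('x \<Rightarrow> 'x \<Rightarrow> 'g) \<Rightarrow> (nat \<Rightarrow> 'x) \<Rightarrow> bool" where
  "cauchy_seq ll d x \<longleftrightarrow>
     (\<forall>\<epsilon>. ll 0 \<epsilon> \<longrightarrow> (\<exists>N. \<forall>n\<ge>N. \<forall>m\<ge>N. ll (d (x n) (x m)) \<epsilon>))"

definition complete_space ::
    "('g::ordered_ab_group_add \<Rightarrow> 'g \<Rightarrow> bool) \<Rightarrow> 'x set \<Rightarrow> ('x \<Rightarrow> 'x \<Rightarrow> 'g) \<Rightarrow> bool" where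
  "complete_space ll X d \<longleftrightarrow>
     (\<forall>x. (\<forall>n. x n \<in> X) \<and> cauchy_seq ll d x \<longrightarrow>
        (\<exists>l\<in>X. converges_to ll (\<lambda>n. d (x n) l) 0))"

definition set_valued_map :: "'x set \<Rightarrow> ('x \<Rightarrow> 'x set) \<Rightarrow> bool" where
  "set_valued_map X T \<longleftrightarrow> (\<forall>x\<in>X. T x \<subseteq> X \<and> T x \<noteq> {})"

definition global_weak_contraction ::
    "'x set \<Rightarrow> ('x \<Rightarrow> 'x \<Rightarrow> 'g::ordered_ab_group_add) \<Rightarrow> ('x \<Rightarrow> 'x \<Rightarrow> 'g) \<Rightarrow> ('x \<Rightarrow> 'x set) \<Rightarrow> bool"
  where
  "global_weak_contraction X d \<phi> T \<longleftrightarrow>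
     (\<forall>x\<in>X. \<forall>y\<in>X. 0 \<le> \<phi> x y) \<and>
     (\<forall>x\<in>X. \<forall>y\<in>X. 0 < d x y \<longrightarrow> \<phi> x y < d x y) \<and>
     set_valued_map X T \<and>
     (\<forall>x\<in>X. \<forall>y\<in>X. x \<noteq> y \<longrightarrow> (\<forall>x'\<in>T x. \<forall>y'\<in>T y. d x' y' \<le> \<phi> x y))"

text \<open>
  On the diagonal \<open>\<phi>\<close> is unconstrained, so \<open>d (x n) (y n) - \<phi> (x n) (y n)\<close> may leave the positive
  cone. By the definition of convergence the hypothesis below covers only sequences of differences
  that stay in the cone; discarding finitely many terms shows that asking for this only eventually
  would give an equivalent condition.
\<close>

definition C_condition ::
    "('g::ordered_ab_group_add \<Rightarrow> 'g \<Rightarrow> bool) \<Rightarrow> 'x set \<Rightarrow> ('x \<Rightarrow> 'x \<Rightarrow> 'g) \<Rightarrow> ('x \<Rightarrow> 'x \<Rightarrow> 'g) \<Rightarrow> bool"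
  where
  "C_condition ll X d \<phi> \<longleftrightarrow>
     (\<forall>x y. (\<forall>n. x n \<in> X) \<and> (\<forall>n. y n \<in> X) \<and>
        converges_to ll (\<lambda>n. d (x n) (y n) - \<phi> (x n) (y n)) 0 \<longrightarrow>
        converges_to ll (\<lambda>n. d (x n) (y n)) 0)"

definition endpoint :: "'x set \<Rightarrow> ('x \<Rightarrow> 'x set) \<Rightarrow> 'x \<Rightarrow> bool" where
  "endpoint X T x \<longleftrightarrow> x \<in> X \<and> T x = {x}"

end

theory Submission imports Defs begin

text \<open>
  If \<open>x n \<noteq> y n\<close> then \<open>d (x n) (y n) - \<phi> (x n) (y n)\<close> is at most
  \<open>d (x n) (y n) - d (x' n) (y' n)\<close> for all images \<open>x' n \<in> T (x n)\<close> and \<open>y' n \<in> T (y n)\<close>.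
  If these images are the next terms of two orbits, the distances decrease, so their differences
  vanish by regularity and the C-condition makes the distances themselves vanish.

  For an orbit without repeated consecutive terms this gives \<open>d (x n) (x (n + 1)) \<rightarrow> 0\<close>; the same
  estimate for \<open>d (x m) (x n)\<close>, together with the triangle inequality, makes the orbit Cauchy, and
  its limit is a fixed point, i.e. \<open>x \<in> T x\<close>. A fixed point \<open>x\<close> is an endpoint: the orbit of
  some \<open>y \<in> T x\<close> with \<open>y \<noteq> x\<close> would converge to \<open>x\<close>, but it also converges to \<open>y\<close>, because
  both \<open>x\<close> and \<open>y\<close> are images of \<open>x\<close>.
\<close>

section \<open>Null sequences in the positive cone\<close>

context analytic_topological_structure
begin

lemma converges_to_zero_iff:
  "converges_to (\<lless>) a 0 \<longleftrightarrow> (\<forall>n. 0 \<le> a n) \<and> (\<forall>\<epsilon>. 0 \<lless> \<epsilon> \<longrightarrow> (\<exists>N. \<forall>n>N. a n \<lless> \<epsilon>))"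
  by (auto simp: converges_to_def)

text \<open>Replaces halving, which a group does not offer: \<open>\<epsilon>\<close> is the sum of
  \<open>\<eta>\<close> and \<open>\<epsilon> - \<eta>\<close>, and translating
  \<open>\<eta> \<lless> \<epsilon>\<close> by \<open>- \<eta>\<close> makes the second part
  positive as well.\<close>

lemma split_pos:
  assumes "0 \<lless> \<epsilon>"
  obtains \<eta> where "0 \<lless> \<eta>" "0 \<lless> \<epsilon> - \<eta>"
proof -
  obtain \<eta> where "0 \<lless> \<eta>" "\<eta> \<lless> \<epsilon>"
    using t5[OF assms] by blast
  with t3[of \<eta> \<epsilon> "- \<eta>"] show thesis
    by (intro that) simp_all
qed

lemma add_way_below:
  assumes "a \<lless> \<eta>" "b \<lless> \<epsilon> - \<eta>"
  shows "a + b \<lless> \<epsilon>"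
proof (rule t2)
  show "a + b \<le> b + \<eta>"
    using t1[OF assms(1)] by (simp add: add.commute less_imp_le)
  show "b + \<eta> \<lless> \<epsilon>"
    using t3[OF assms(2), of \<eta>] by simp
qed

lemma converges_to_zero_add:
  assumes "converges_to (\<lless>) a 0" "converges_to (\<lless>) b 0"
  shows "converges_to (\<lless>) (\<lambda>n. a n + b n) 0"
  unfolding converges_to_zero_iff
proof (intro conjI allI impI)
  show "0 \<le> a n + b n" for n
    using assms by (simp add: converges_to_zero_iff)
  fix \<epsilon> :: 'g assume "0 \<lless> \<epsilon>"
  then obtain \<eta> where "0 \<lless> \<eta>" "0 \<lless> \<epsilon> - \<eta>"
    by (rule split_pos)
  then obtain M N where "\<forall>n>M. a n \<lless> \<eta>" "\<forall>n>N. b n \<lless> \<epsilon> - \<eta>"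
    using assms unfolding converges_to_zero_iff by blast
  then show "\<exists>N. \<forall>n>N. a n + b n \<lless> \<epsilon>"
    by (intro exI[of _ "max M N"]) (auto intro: add_way_below)
qed

lemma converges_to_zero_le:
  assumes "converges_to (\<lless>) b 0" "\<And>n. 0 \<le> a n" "\<And>n. a n \<le> b n"
  shows "converges_to (\<lless>) a 0"
  using assms unfolding converges_to_zero_iff by (meson t2)

text \<open>The bound \<open>n \<le> f n\<close> carries tails into tails. It suits index functions
  obtained by choice, which may fail to be monotone.\<close>

lemma converges_to_zero_subseq:
  assumes "converges_to (\<lless>) a 0" "\<And>n. n \<le> f n"
  shows "converges_to (\<lless>) (\<lambda>n. a (f n)) 0"
  using assms unfolding converges_to_zero_iff by (meson less_le_trans)

text \<open>Every tail has a term above \<open>c\<close>, so \<open>c\<close> is way below each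
  positive \<open>\<epsilon>\<close> and t4 applies. Asking for the bound only frequently allows for
  orbits that visit their limit now and then.\<close>

lemma eq_zero_if_frequently_le:
  assumes "converges_to (\<lless>) a 0" "0 \<le> c" "\<And>N. \<exists>n>N. c \<le> a n"
  shows "c = 0"
proof (rule t4[OF assms(2)])
  fix \<epsilon> :: 'g assume "0 \<lless> \<epsilon>"
  then obtain N where "\<forall>n>N. a n \<lless> \<epsilon>"
    using assms(1) unfolding converges_to_zero_iff by blast
  with assms(3)[of N] show "c \<lless> \<epsilon>"
    by (blast intro: t2)
qed

text \<open>Convergence is from above, so the limit \<open>l\<close> lies below all late terms, and
  \<open>a n - a (Suc n)\<close> is squeezed between \<open>0\<close> and
  \<open>a n - l\<close>.\<close>

lemma decreasing_differences_converge_to_zero: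
  assumes "regular_group (\<lless>)" "\<And>n. 0 \<le> a n" "\<And>n. a (Suc n) \<le> a n"
  shows "converges_to (\<lless>) (\<lambda>n. a n - a (Suc n)) 0"
  unfolding converges_to_zero_iff
proof (intro conjI allI impI)
  show "0 \<le> a n - a (Suc n)" for n
    using assms(3) by simp
  obtain l where l: "converges_to (\<lless>) a l"
    using assms unfolding regular_group_def by blast
  fix \<epsilon> :: 'g assume "0 \<lless> \<epsilon>"
  then obtain N where N: "\<forall>n>N. 0 \<le> a n - l \<and> a n - l \<lless> \<epsilon>"
    using l unfolding converges_to_def by blast
  have "a n - a (Suc n) \<lless> \<epsilon>" if "n > N" for n
  proof (rule t2)
    show "a n - l \<lless> \<epsilon>"
      using N that by blast
    have "l \<le> a (Suc n)"
      using N[rule_format, of "Suc n"] that by simp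
    then show "a n - a (Suc n) \<le> a n - l"
      by (rule diff_left_mono)
  qed
  then show "\<exists>N. \<forall>n>N. a n - a (Suc n) \<lless> \<epsilon>"
    by blast
qed

end

section \<open>Orbits of the contraction\<close>

locale complete_regular_weak_contraction =
  analytic_topological_structure way_below + group_valued_metric_space X d
  for way_below :: "'g::ordered_ab_group_add \<Rightarrow> 'g \<Rightarrow> bool" (infix \<open>\<lless>\<close> 50)
    and X :: "'x set" and d :: "'x \<Rightarrow> 'x \<Rightarrow> 'g" +
  fixes \<phi> :: "'x \<Rightarrow> 'x \<Rightarrow> 'g" and T :: "'x \<Rightarrow> 'x set"
  assumes complete: "complete_space (\<lless>) X d"
    and regular: "regular_group (\<lless>)"
    and contraction: "global_weak_contraction X d \<phi> T"
    and C_cond: "C_condition (\<lless>) X d \<phi>"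
begin

lemma image_in_carrier: "x \<in> X \<Longrightarrow> x' \<in> T x \<Longrightarrow> x' \<in> X"
  using contraction unfolding global_weak_contraction_def set_valued_map_def by blast

lemma phi_less: "x \<in> X \<Longrightarrow> y \<in> X \<Longrightarrow> x \<noteq> y \<Longrightarrow> \<phi> x y < d x y"
  using contraction nonneg[of x y] zero_iff[of x y]
  unfolding global_weak_contraction_def by (metis order_le_less)

lemma image_dist_le:
  "x \<in> X \<Longrightarrow> y \<in> X \<Longrightarrow> x \<noteq> y \<Longrightarrow> x' \<in> T x \<Longrightarrow> y' \<in> T y \<Longrightarrow> d x' y' \<le> \<phi> x y"
  using contraction unfolding global_weak_contraction_def by blast

lemma image_dist_less:
  "x \<in> X \<Longrightarrow> y \<in> X \<Longrightarrow> x \<noteq> y \<Longrightarrow> x' \<in> T x \<Longrightarrow> y' \<in> T y \<Longrightarrow> d x' y' < d x y"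
  by (meson image_dist_le phi_less order_le_less_trans)

lemma orbit_exists:
  assumes "x\<^sub>0 \<in> X"
  obtains x where "x 0 = x\<^sub>0" "\<And>n. x n \<in> X" "\<And>n. x (Suc n) \<in> T (x n)"
proof -
  define x where "x = rec_nat x\<^sub>0 (\<lambda>_ u. SOME v. v \<in> T u)"
  have nonempty_image: "\<exists>v. v \<in> T u" if "u \<in> X" for u
    using contraction that unfolding global_weak_contraction_def set_valued_map_def by blast
  have step: "x (Suc n) \<in> T (x n)" if "x n \<in> X" for n
    using someI_ex[OF nonempty_image[OF that]] by (simp add: x_def)
  have carrier: "x n \<in> X" for n
  proof (induction n)
    case 0
    show ?case using assms by (simp add: x_def)
  next
    case (Suc n)
    then show ?case using step image_in_carrier by blast
  qed
  have "x 0 = x\<^sub>0"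
    by (simp add: x_def)
  then show thesis
    using carrier step[OF carrier] by (rule that)
qed

text \<open>The C-condition in comparison form: distinct points keep the differences in the positive
  cone, so the null sequence \<open>e\<close> forces them to converge to \<open>0\<close>.\<close>

lemma dist_converges_to_zero:
  assumes "\<And>n. x n \<in> X" "\<And>n. y n \<in> X" "\<And>n. x n \<noteq> y n"
    and "\<And>n. d (x n) (y n) - \<phi> (x n) (y n) \<le> e n" "converges_to (\<lless>) e 0"
  shows "converges_to (\<lless>) (\<lambda>n. d (x n) (y n)) 0"
proof -
  have "0 \<le> d (x n) (y n) - \<phi> (x n) (y n)" for n
    using phi_less[OF assms(1-3)] by (simp add: less_imp_le)
  then have "converges_to (\<lless>) (\<lambda>n. d (x n) (y n) - \<phi> (x n) (y n)) 0"
    by (intro converges_to_zero_le[OF assms(5)] assms(4))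
  then show ?thesis
    using C_cond assms(1,2) unfolding C_condition_def by blast
qed

lemma orbit_dist_converges_to_zero:
  assumes "\<And>n. x n \<in> X" "\<And>n. y n \<in> X" "\<And>n. x n \<noteq> y n"
    and "\<And>n. x (Suc n) \<in> T (x n)" "\<And>n. y (Suc n) \<in> T (y n)"
  shows "converges_to (\<lless>) (\<lambda>n. d (x n) (y n)) 0"
proof (rule dist_converges_to_zero)
  show "d (x n) (y n) - \<phi> (x n) (y n) \<le> d (x n) (y n) - d (x (Suc n)) (y (Suc n))" for n
    by (intro diff_left_mono image_dist_le assms)
  show "converges_to (\<lless>) (\<lambda>n. d (x n) (y n) - d (x (Suc n)) (y (Suc n))) 0"
    by (intro decreasing_differences_converge_to_zero[OF regular]
        nonneg less_imp_le[OF image_dist_less] assms)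
qed (use assms in auto)

section \<open>Fixed points and endpoints\<close>

lemma fixed_point_is_endpoint:
  assumes "x \<in> X" "x \<in> T x"
  shows "T x = {x}"
proof -
  have "y = x" if "y \<in> T x" for y
  proof (rule ccontr)
    assume "y \<noteq> x"
    have "y \<in> X"
      using assms(1) that by (rule image_in_carrier)
    then obtain u where u: "u 0 = y" "\<And>n. u n \<in> X" "\<And>n. u (Suc n) \<in> T (u n)"
      by (rule orbit_exists) blast
    \<comment> \<open>The bound on the distance keeps the orbit away from \<open>x\<close>: since
      \<open>y \<in> T x\<close>, reaching \<open>x\<close> at the next term would give
      \<open>d x y < d y x\<close>.\<close>
    have "u n \<noteq> x \<and> d (u n) x \<le> d y x" for n
    proof (induction n)
      case 0
      then show ?case using u(1) \<open>y \<noteq> x\<close> by simp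
    next
      case (Suc n)
      have "d (u (Suc n)) y < d y x" "d (u (Suc n)) x < d y x"
        using image_dist_less[of "u n" x "u (Suc n)"] Suc u assms that
        by (meson order_less_le_trans)+
      then show ?case
        using commute[OF assms(1) \<open>y \<in> X\<close>] by auto
    qed
    then have ux: "u n \<noteq> x" for n
      by blast
    \<comment> \<open>The constant sequence \<open>x\<close> is itself an orbit, because
      \<open>x \<in> T x\<close>.\<close>
    have lim: "converges_to (\<lless>) (\<lambda>n. d (u n) x) 0"
      using orbit_dist_converges_to_zero[of u "\<lambda>_. x"] u ux assms by blast
    have "d x y \<le> d (u (Suc n)) x + d (u n) x" for n
    proof -
      have "d x y \<le> d x (u (Suc n)) + d (u (Suc n)) y"
        by (intro triangle assms u \<open>y \<in> X\<close>)
      also have "\<dots> \<le> d (u (Suc n)) x + d (u n) x"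
        using image_dist_less[OF u(2) assms(1) ux u(3) that, of n] commute[OF assms(1) u(2)]
        by (simp add: less_imp_le)
      finally show ?thesis .
    qed
    moreover have "converges_to (\<lless>) (\<lambda>n. d (u (Suc n)) x + d (u n) x) 0"
      by (intro converges_to_zero_add converges_to_zero_subseq[OF lim] lim) simp
    ultimately have "d x y = 0"
      using eq_zero_if_frequently_le nonneg[OF assms(1) \<open>y \<in> X\<close>] lessI by meson
    then show False
      using zero_iff[OF assms(1) \<open>y \<in> X\<close>] \<open>y \<noteq> x\<close> by simp
  qed
  then show ?thesis
    using assms(2) by blast
qed

lemma orbit_cauchy:
  assumes "\<And>n. x n \<in> X" "\<And>n. x (Suc n) \<in> T (x n)" "\<And>n. x (Suc n) \<noteq> x n"
  shows "cauchy_seq (\<lless>) d x"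
  unfolding cauchy_seq_def
proof (rule ccontr)
  assume "\<not> (\<forall>\<epsilon>. 0 \<lless> \<epsilon> \<longrightarrow> (\<exists>N. \<forall>n\<ge>N. \<forall>m\<ge>N. d (x n) (x m) \<lless> \<epsilon>))"
  then obtain \<epsilon> where \<epsilon>: "0 \<lless> \<epsilon>"
    and "\<forall>k. \<exists>n m. n \<ge> k \<and> m \<ge> k \<and> \<not> d (x n) (x m) \<lless> \<epsilon>"
    by blast
  then obtain f g where fg: "\<And>k. k \<le> f k" "\<And>k. k \<le> g k"
    and far: "\<And>k. \<not> d (x (f k)) (x (g k)) \<lless> \<epsilon>"
    by metis
  let ?s = "\<lambda>n. d (x n) (x (Suc n))"
  \<comment> \<open>The orbit is paired with its own shift.\<close>
  have s: "converges_to (\<lless>) ?s 0"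
    using assms(3) by (intro orbit_dist_converges_to_zero[of x "\<lambda>n. x (Suc n)"] assms) metis
  \<comment> \<open>Equal points would have distance \<open>0\<close>, which is way below
    \<open>\<epsilon>\<close>.\<close>
  have ne: "x (f k) \<noteq> x (g k)" for k
    using far[of k] \<epsilon> zero_iff[OF assms(1) assms(1)] by metis
  have "converges_to (\<lless>) (\<lambda>k. d (x (f k)) (x (g k))) 0"
  proof (rule dist_converges_to_zero[OF assms(1) assms(1) ne])
    show "converges_to (\<lless>) (\<lambda>k. ?s (f k) + ?s (g k)) 0"
      by (intro converges_to_zero_add converges_to_zero_subseq[OF s] fg)
    fix k
    let ?m = "f k" and ?n = "g k"
    \<comment> \<open>A detour through the two next terms costs one step at each end and leaves a
      middle distance bounded by \<open>\<phi>\<close>.\<close>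
    have "d (x ?m) (x ?n) \<le> ?s ?m + d (x (Suc ?m)) (x ?n)"
      by (intro triangle assms)
    also have "\<dots> \<le> ?s ?m + (d (x (Suc ?m)) (x (Suc ?n)) + d (x (Suc ?n)) (x ?n))"
      by (intro add_left_mono triangle assms)
    also have "\<dots> = ?s ?m + (d (x (Suc ?m)) (x (Suc ?n)) + ?s ?n)"
      by (simp only: commute[OF assms(1) assms(1), of "Suc ?n" ?n])
    also have "\<dots> \<le> ?s ?m + (\<phi> (x ?m) (x ?n) + ?s ?n)"
      by (intro add_left_mono add_right_mono image_dist_le assms ne)
    finally show "d (x ?m) (x ?n) - \<phi> (x ?m) (x ?n) \<le> ?s ?m + ?s ?n"
      by (simp add: algebra_simps)
  qed
  then show False
    using far \<epsilon> unfolding converges_to_zero_iff by blast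
qed

lemma fixed_point_exists: "\<exists>x\<in>X. x \<in> T x"
proof (rule ccontr)
  \<comment> \<open>Without fixed points no orbit repeats consecutive terms, so the Cauchy argument
    applies; the contradiction arises at the limit.\<close>
  assume "\<not> ?thesis"
  then have no_fixed: "x \<notin> T x" if "x \<in> X" for x
    using that by blast
  obtain x\<^sub>0 where "x\<^sub>0 \<in> X"
    using carrier_nonempty by blast
  then obtain x where x: "\<And>n. x n \<in> X" "\<And>n. x (Suc n) \<in> T (x n)"
    by (rule orbit_exists) blast
  have steps: "x (Suc n) \<noteq> x n" for n
    using no_fixed x by metis
  obtain l where l: "l \<in> X" and lim: "converges_to (\<lless>) (\<lambda>n. d (x n) l) 0"
    using complete orbit_cauchy[of x, OF x steps] x(1) unfolding complete_space_def by blast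
  obtain y where y: "y \<in> T l"
    using contraction l unfolding global_weak_contraction_def set_valued_map_def by blast
  have "y \<in> X"
    using l y by (rule image_in_carrier)
  have "d l y \<le> d (x (Suc n)) l + d (x n) l" if "x n \<noteq> l" for n
  proof -
    have "d l y \<le> d l (x (Suc n)) + d (x (Suc n)) y"
      by (intro triangle l x \<open>y \<in> X\<close>)
    also have "\<dots> \<le> d (x (Suc n)) l + d (x n) l"
      using image_dist_less[OF x(1) l that x(2) y] commute[OF l x(1)]
      by (simp add: less_imp_le)
    finally show ?thesis .
  qed
  \<comment> \<open>Two consecutive terms differ, so they cannot both equal
    \<open>l\<close>.\<close>
  moreover have "\<exists>n>N. x n \<noteq> l" for N
    using steps[of "Suc N"] by (metis lessI less_SucI)
  ultimately have frequently: "\<exists>n>N. d l y \<le> d (x (Suc n)) l + d (x n) l" for N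
    by meson
  have "converges_to (\<lless>) (\<lambda>n. d (x (Suc n)) l + d (x n) l) 0"
    by (intro converges_to_zero_add converges_to_zero_subseq[OF lim] lim) simp
  then have "d l y = 0"
    using nonneg[OF l \<open>y \<in> X\<close>] frequently by (rule eq_zero_if_frequently_le)
  then show False
    using zero_iff[OF l \<open>y \<in> X\<close>] y no_fixed[OF l] by simp
qed

lemma endpoint_exists_unique: "\<exists>!x. endpoint X T x"
proof -
  obtain x where x: "x \<in> X" "x \<in> T x"
    using fixed_point_exists by blast
  \<comment> \<open>Two distinct endpoints are images of themselves, and the contraction would give
    \<open>d z x < d z x\<close>.\<close>
  have "z = x" if "endpoint X T z" for z
    using image_dist_less[of z x z x] that x unfolding endpoint_def by auto
  moreover have "endpoint X T x"
    using x fixed_point_is_endpoint unfolding endpoint_def by blast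
  ultimately show ?thesis
    by blast
qed

end

theorem theorem3p3:
  fixes ll :: "'g::ordered_ab_group_add \<Rightarrow> 'g \<Rightarrow> bool"
    and X :: "'x set"
    and d \<phi> :: "'x \<Rightarrow> 'x \<Rightarrow> 'g"
    and T :: "'x \<Rightarrow> 'x set"
  assumes "\<exists>a::'g. a \<noteq> 0"
    and "analytic_topological_structure ll"
    and "group_valued_metric_space X d"
    and "complete_space ll X d"
    and "regular_group ll"
    and "global_weak_contraction X d \<phi> T"
    and "C_condition ll X d \<phi>"
  shows "\<exists>!x. endpoint X T x"
proof -
  interpret analytic_topological_structure ll by fact
  interpret group_valued_metric_space X d by fact
  interpret complete_regular_weak_contraction ll X d \<phi> T
    by unfold_locales fact+
  show ?thesis
    by (rule endpoint_exists_unique)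
qed

end
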